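(* The equation $t_z = \frac{x^4 + y^4}{2}$ has infinitely many non-trivial solutions in integers $x, y, z$, where a solution is called trivial if it is of the form $x = m$, $y = m^2$, $z = m^4$ for some $m \in \mathbb{N}$. In other words, there are infinitely many three-term arithmetic progressions consisting of the numbers $x^4, t_z, y^4$ not arising from such trivial solutions.
   Context: $t_n = \frac{n(n+1)}{2}$ denotes the $n$-th triangular number. *)

theory Defs
  imports Complex_Main
begin

definition triangular :: "int \<Rightarrow> rat" where
  "triangular n = of_int n * (of_int n + 1) / 2"

definition is_solution :: "int \<Rightarrow> int \<Rightarrow> int \<Rightarrow> bool" where
  "is_solution x y z \<longleftrightarrow> triangular z = (of_int x ^ 4 + of_int y ^ 4) / 2"

definition is_trivial :: "int \<Rightarrow> int \<Rightarrow> int \<Rightarrow> bool" where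
  "is_trivial x y z \<longleftrightarrow> (\<exists>m::nat. x = int m \<and> y = int m ^ 2 \<and> z = int m ^ 4)"

definition three_term_AP :: "rat \<Rightarrow> rat \<Rightarrow> rat \<Rightarrow> bool" where
  "three_term_AP a b c \<longleftrightarrow> b - a = c - b"

(* A progression is recorded as the set of its terms, so that it does not depend on the
   signs of x and y, on replacing z by -1 - z, or on the direction in which it is read.
   In particular, exchanging x and y in a trivial solution gives no new progression. *)
definition progression_terms :: "int \<Rightarrow> int \<Rightarrow> int \<Rightarrow> rat set" where
  "progression_terms x y z = {of_int x ^ 4, triangular z, of_int y ^ 4}"

end

theory Submission
  imports Defs
begin

text \<open>
  Put \<open>z = y\<^sup>2 + k\<close>, \<open>d = 2k + 1\<close>. Then \<open>z(z + 1) = x\<^sup>4 + y\<^sup>4\<close> says that \<open>4x\<^sup>4 + 1 = d e\<close> with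
  \<open>e - d = 4y\<^sup>2\<close>. As \<open>4x\<^sup>4 + 1 = (2x\<^sup>2 - 2x + 1)(2x\<^sup>2 + 2x + 1)\<close>, one may try
  \<open>d = (2x\<^sup>2 - 2x + 1)/5\<close>, \<open>e = 5(2x\<^sup>2 + 2x + 1)\<close>, which leaves the conic
  \<open>5y\<^sup>2 = 12x\<^sup>2 + 13x + 6\<close>, i.e. \<open>(24x + 13)\<^sup>2 - 240y\<^sup>2 = -119\<close>. It contains the point \<open>(2, 4)\<close>
  of a trivial solution, and multiplication by powers of the unit
  \<open>(31 + 2\<surd>240)\<^sup>2 = 1921 + 124\<surd>240\<close> gives infinitely many further integral points; on them
  \<open>x < y < x\<^sup>2\<close>, which excludes trivial progressions.
\<close>

text \<open>The start is the image of \<open>(2, 4)\<close> under the step; \<open>(2, 4)\<close>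
  itself is left out as trivial. The unit is squared since \<open>31 + 2 sqrt 240\<close> alone
  would add the non-integer \<open>65/4\<close> to \<open>x\<close>.\<close>

primrec conic_point :: "nat \<Rightarrow> int \<times> int" where
  "conic_point 0 = (9842, 15248)"
| "conic_point (Suc n) =
    (case conic_point n of (x, y) \<Rightarrow> (1921 * x + 1240 * y + 1040, 2976 * x + 1921 * y + 1612))"

definition conic_x :: "nat \<Rightarrow> int" where "conic_x n = fst (conic_point n)"
definition conic_y :: "nat \<Rightarrow> int" where "conic_y n = snd (conic_point n)"
text \<open>This is \<open>y^2 + k\<close> with \<open>k = (d - 1) / 2\<close>, where
  \<open>y^2\<close> is eliminated by the conic.\<close>

definition conic_z :: "nat \<Rightarrow> int" where
  "conic_z n = (13 * conic_x n ^ 2 + 12 * conic_x n + 4) div 5"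

lemma conic_0: "conic_x 0 = 9842" "conic_y 0 = 15248"
  by (simp_all add: conic_x_def conic_y_def)

lemma conic_Suc:
  "conic_x (Suc n) = 1921 * conic_x n + 1240 * conic_y n + 1040"
  "conic_y (Suc n) = 2976 * conic_x n + 1921 * conic_y n + 1612"
  by (simp_all add: conic_x_def conic_y_def split: prod.split)

lemma conic_x_gt_2: "2 < conic_x n" and conic_y_pos: "0 < conic_y n"
  by (induction n) (auto simp: conic_0 conic_Suc)

lemma conic_equation: "5 * conic_y n ^ 2 = 12 * conic_x n ^ 2 + 13 * conic_x n + 6"
proof (induction n)
  case 0
  show ?case by (simp add: conic_0)
next
  case (Suc n)
  \<comment> \<open>The step preserves the defining polynomial of the conic at every
    \<open>x\<close>, \<open>y\<close>, not only at its zeros.\<close>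
  have "5 * (2976 * x + 1921 * y + 1612) ^ 2 - (12 * (1921 * x + 1240 * y + 1040) ^ 2
      + 13 * (1921 * x + 1240 * y + 1040) + 6) = 5 * y ^ 2 - (12 * x ^ 2 + 13 * x + 6)" for x y :: int
    by (simp add: power2_eq_square algebra_simps)
  from this[of "conic_x n" "conic_y n"] Suc show ?case unfolding conic_Suc by linarith
qed

text \<open>Makes the \<open>div\<close> in \<open>conic_z\<close> exact.\<close>

lemma conic_x_mod_5: "conic_x n mod 5 = 2"
proof (induction n)
  case 0
  show ?case by (simp add: conic_0)
next
  case (Suc n)
  have "conic_x (Suc n) = conic_x n + (384 * conic_x n + 248 * conic_y n + 208) * 5"
    by (simp add: conic_Suc)
  then show ?case using Suc by (metis mod_mult_self1)
qed

lemma strict_mono_conic_x: "strict_mono conic_x"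
unfolding strict_mono_Suc_iff
proof
  fix n show "conic_x n < conic_x (Suc n)"
    using conic_x_gt_2[of n] conic_y_pos[of n] by (simp add: conic_Suc)
qed

lemma conic_x_less_y: "conic_x n < conic_y n"
proof (rule power_less_imp_less_base)
  show "conic_x n ^ 2 < conic_y n ^ 2"
    using conic_equation[of n] conic_x_gt_2[of n] zero_le_power2[of "conic_x n"] by linarith
qed (use conic_y_pos[of n] in simp)

text \<open>A trivial solution has \<open>y = x^2\<close>. Equality holds at the point
  \<open>(2, 4)\<close>, so the bound \<open>2 < x\<close> is sharp here.\<close>

lemma conic_y_less_x_squared: "conic_y n < conic_x n ^ 2"
proof (rule power_less_imp_less_base)
  have x: "3 \<le> conic_x n" using conic_x_gt_2[of n] by simp
  have sq: "3 * conic_x n \<le> conic_x n ^ 2" using x by (simp add: power2_eq_square)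
  have "9 * conic_x n ^ 2 \<le> conic_x n ^ 2 * conic_x n ^ 2"
    using sq x by (intro mult_right_mono) auto
  then have "5 * conic_y n ^ 2 < 5 * (conic_x n ^ 2 * conic_x n ^ 2)"
    using conic_equation[of n] sq x by linarith
  then show "conic_y n ^ 2 < (conic_x n ^ 2) ^ 2" by (simp add: power2_eq_square)
qed simp

lemma conic_z_times_5: "5 * conic_z n = 13 * conic_x n ^ 2 + 12 * conic_x n + 4"
proof -
  obtain u where "conic_x n = 5 * u + 2"
    using conic_x_mod_5[of n] by (metis mult_div_mod_eq)
  then have "13 * conic_x n ^ 2 + 12 * conic_x n + 4 = 5 * (65 * u ^ 2 + 64 * u + 16)"
    by (simp add: power2_eq_square algebra_simps)
  then show ?thesis by (simp add: conic_z_def)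
qed

lemma conic_solution: "is_solution (conic_x n) (conic_y n) (conic_z n)"
proof -
  \<comment> \<open>The factor 25 lets \<open>5 z\<close> and \<open>5 y^2\<close> be replaced by
    quadratics in \<open>x\<close>, leaving a polynomial identity in \<open>x\<close> alone.\<close>
  have "25 * (conic_z n * (conic_z n + 1)) = 5 * conic_z n * (5 * conic_z n + 5)"
    by (simp add: algebra_simps)
  also have "\<dots> = 25 * conic_x n ^ 4 + (5 * conic_y n ^ 2) ^ 2"
    unfolding conic_equation conic_z_times_5 by (simp add: power2_eq_square power4_eq_xxxx algebra_simps)
  also have "\<dots> = 25 * (conic_x n ^ 4 + conic_y n ^ 4)"
    by (simp add: power_mult_distrib flip: power_mult)
  finally have "conic_z n * (conic_z n + 1) = conic_x n ^ 4 + conic_y n ^ 4" by simp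
  then have "(of_int (conic_z n * (conic_z n + 1)) :: rat) = of_int (conic_x n ^ 4 + conic_y n ^ 4)"
    by (rule arg_cong)
  then show ?thesis by (simp add: is_solution_def triangular_def)
qed

lemma is_solution_iff_three_term_AP:
  "is_solution x y z \<longleftrightarrow> three_term_AP (of_int x ^ 4) (triangular z) (of_int y ^ 4)"
  unfolding is_solution_def three_term_AP_def by (auto simp: field_simps)

lemma trivial_is_solution: "is_trivial x y z \<Longrightarrow> is_solution x y z"
  by (auto simp: is_trivial_def is_solution_def triangular_def algebra_simps simp flip: power_mult power_add)

text \<open>The middle term is the mean of the outer ones, so even the unordered set of terms
  reveals its endpoints.\<close>

lemma solution_Min_Max_progression_terms:
  assumes "is_solution x y z" "0 \<le> x" "x \<le> y"
  shows "Min (progression_terms x y z) = of_int x ^ 4"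
    and "Max (progression_terms x y z) = of_int y ^ 4"
proof -
  have "(of_int x :: rat) ^ 4 \<le> of_int y ^ 4"
    using assms(2,3) by (intro power_mono) auto
  moreover have "of_int x ^ 4 \<le> triangular z" "triangular z \<le> of_int y ^ 4"
    using assms(1) calculation by (auto simp: is_solution_def)
  ultimately show "Min (progression_terms x y z) = of_int x ^ 4"
    "Max (progression_terms x y z) = of_int y ^ 4"
    by (auto simp: progression_terms_def)
qed

lemma solution_progression_terms_inject:
  assumes "is_solution x y z" "0 \<le> x" "x \<le> y"
    and "is_solution x' y' z'" "0 \<le> x'" "x' \<le> y'"
    and "progression_terms x y z = progression_terms x' y' z'"
  shows "x = x'" "y = y'"
proof -
  have eq: "(of_int x :: rat) ^ 4 = of_int x' ^ 4" "(of_int y :: rat) ^ 4 = of_int y' ^ 4"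
    using solution_Min_Max_progression_terms[OF assms(1-3)]
      solution_Min_Max_progression_terms[OF assms(4-6)] assms(7) by simp_all
  have "(of_int x :: rat) = of_int x'"
    using eq(1) by (rule power_eq_imp_eq_base) (use assms in auto)
  then show "x = x'" by simp
  have "(of_int y :: rat) = of_int y'"
    using eq(2) by (rule power_eq_imp_eq_base) (use assms in auto)
  then show "y = y'" by simp
qed

lemma conic_progression_nontrivial:
  assumes "is_trivial x y z"
  shows "progression_terms (conic_x n) (conic_y n) (conic_z n) \<noteq> progression_terms x y z"
proof
  assume eq: "progression_terms (conic_x n) (conic_y n) (conic_z n) = progression_terms x y z"
  obtain m :: nat where m: "x = int m" "y = int m ^ 2"
    using assms by (auto simp: is_trivial_def)
  \<comment> \<open>Puts the trivial solution into the order \<open>0 \<le> x \<le> y\<close> needed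
    to compare endpoints.\<close>
  have "m \<le> m ^ 2" by (simp add: power2_eq_square)
  then have "int m \<le> int m ^ 2" by (metis of_nat_le_iff of_nat_power)
  then have "x \<le> y" "0 \<le> x" by (simp_all add: m)
  then have "conic_x n = x" "conic_y n = y"
    using solution_progression_terms_inject[OF conic_solution _ _ trivial_is_solution[OF assms] _ _ eq]
      conic_x_gt_2[of n] conic_x_less_y[of n] by simp_all
  then show False using conic_y_less_x_squared[of n] m by simp
qed

theorem theorem4p3:
  shows "infinite {(x, y, z). is_solution x y z \<and> \<not> is_trivial x y z} \<and>
    infinite ({progression_terms x y z | x y z.
                 three_term_AP (of_int x ^ 4) (triangular z) (of_int y ^ 4)} -
              {progression_terms x y z | x y z. is_trivial x y z})"
    (is "infinite ?S \<and> infinite ?P")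
proof
  let ?f = "\<lambda>n. progression_terms (conic_x n) (conic_y n) (conic_z n)"
  have "inj ?f"
  proof (rule injI)
    fix i j assume "?f i = ?f j"
    then have "conic_x i = conic_x j"
      using solution_progression_terms_inject(1)[OF conic_solution _ _ conic_solution]
        conic_x_gt_2[of i] conic_x_gt_2[of j] conic_x_less_y[of i] conic_x_less_y[of j]
      by (meson less_imp_le less_trans zero_less_numeral)
    then show "i = j" by (simp add: strict_mono_eq[OF strict_mono_conic_x])
  qed
  then have "infinite (range ?f)" by (simp add: finite_image_iff)
  moreover have "range ?f \<subseteq> ?P"
    using conic_solution conic_progression_nontrivial
    by (fastforce simp flip: is_solution_iff_three_term_AP)
  ultimately show P: "infinite ?P" by (meson finite_subset)
  \<comment> \<open>A progression in \<open>?P\<close> can only come from a non-trivial solution, so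
    infinitely many progressions force infinitely many such solutions.\<close>
  have "?P \<subseteq> (\<lambda>(x, y, z). progression_terms x y z) ` ?S"
    by (force simp flip: is_solution_iff_three_term_AP)
  then show "infinite ?S" using P by (meson finite_imageI finite_subset)
qed

end
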